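(* Let $m\ge 1$, let $(p_i(n))_{n\ge 1}$, $1\le i\le m$, be sequences of nonnegative real numbers, and let $(\sigma_i(n))_{n\ge 1}$, $1\le i\le m$, be sequences of integers such that $\sigma_i(n)\ge n+1$ for all $n\ge 1$ and there exist $\mu_i>0$ such that $\sigma_i(n)-n\le\mu_i$ for all $n\ge 1$, $1\le i\le m$. If $$\liminf_{n\to\infty}\sum_{i=1}^{m}\sum_{j=n+1}^{\sigma_k(n)}p_i(j)>\left(\frac{\mu_k}{\mu_k+1}\right)^{\mu_k+1},\qquad k=1,\dots,m,$$ then all solutions of the difference equation $$\nabla x(n)-\sum_{i=1}^m p_i(n)\,x(\sigma_i(n))=0,\qquad n\ge 1,$$ oscillate.
   Context: $\nabla x(n)=x(n)-x(n-1)$. A solution of the equation is a real sequence $(x(n))_{n\ge 0}$ satisfying the equation for all $n\ge 1$. A solution is oscillatory (oscillates) if it is neither eventually positive nor eventually negative. *)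

theory Defs
  imports Complex_Main "HOL-Library.Extended_Real" "HOL-Library.Liminf_Limsup"
begin

text \<open>Only used at \<open>n \<ge> 1\<close>; at \<open>n = 0\<close> the truncated subtraction makes it \<open>0\<close>.\<close>

definition backward_diff :: "(nat \<Rightarrow> real) \<Rightarrow> nat \<Rightarrow> real" ("\<nabla>") where
  "\<nabla> x n = x n - x (n - 1)"

text \<open>The advanced arguments \<open>\<sigma> i n\<close> are integers; wherever the predicate is used they
  satisfy \<open>\<sigma> i n \<ge> n + 1\<close>, so the coercion \<open>nat\<close> loses nothing.\<close>

definition is_solution ::
  "nat \<Rightarrow> (nat \<Rightarrow> nat \<Rightarrow> real) \<Rightarrow> (nat \<Rightarrow> nat \<Rightarrow> int) \<Rightarrow> (nat \<Rightarrow> real) \<Rightarrow> bool" where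
  "is_solution m p \<sigma> x \<longleftrightarrow>
     (\<forall>n\<ge>1. \<nabla> x n - (\<Sum>i=1..m. p i n * x (nat (\<sigma> i n))) = 0)"

definition oscillatory :: "(nat \<Rightarrow> real) \<Rightarrow> bool" where
  "oscillatory x \<longleftrightarrow>
     \<not> (\<forall>\<^sub>F n in sequentially. x n > 0) \<and> \<not> (\<forall>\<^sub>F n in sequentially. x n < 0)"

end

theory Submission
  imports Defs
begin

text \<open>
  Suppose \<open>x\<close> is eventually positive. If \<open>x (\<sigma> k j) \<ge> w * x j\<close> for all \<open>k\<close> and all large \<open>j\<close>, then each
  ratio \<open>x (j - 1) / x j\<close> is at most \<open>1 - w * (\<Sum>i. p i j)\<close>. Multiplying the ratios for \<open>n < j \<le> \<sigma> k n\<close>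
  telescopes to \<open>x n / x (\<sigma> k n)\<close>, and the inequality of arithmetic and geometric means improves
  \<open>w\<close> to \<open>q * w\<close>, where \<open>q > 1\<close> is given by the strict lower limit hypothesis. The range of \<open>n\<close>
  does not shrink because the equation only looks forward, so iterating makes \<open>x (\<sigma> k n) / x n\<close>
  unbounded at a fixed \<open>n\<close>.
\<close>

text \<open>Weighted AM-GM applied to \<open>a\<close>, the \<open>b j\<close>, and the number 1 with weight \<open>\<mu> - card A\<close>, of total
  weight \<open>\<mu> + 1\<close>; this handles all interval lengths up to the real number \<open>\<mu>\<close> uniformly.\<close>

lemma mult_prod_le_powr:
  fixes a \<mu> :: real and b :: "'a \<Rightarrow> real"
  assumes "finite A" and a: "a > 0" and b: "\<And>j. j \<in> A \<Longrightarrow> b j > 0"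
    and \<mu>: "\<mu> > 0" "real (card A) \<le> \<mu>"
    and le: "a + sum b A \<le> real (card A)"
  shows "a * prod b A \<le> (\<mu> / (\<mu> + 1)) powr (\<mu> + 1)"
proof -
  define c where "c = \<mu> / (\<mu> + 1)"
  have c: "c > 0" using \<mu> by (simp add: c_def)
  \<comment> \<open>The tangent to \<open>ln\<close> is taken at \<open>c\<close> because
    \<open>le\<close> bounds the weighted mean of \<open>a\<close>, the \<open>b j\<close> and 1 by
    \<open>\<mu> / (\<mu> + 1)\<close>; after summation the linear terms then contribute at most
    0.\<close>
  have tangent: "ln t \<le> t / c - 1 + ln c" if "t > 0" for t
    using ln_le_minus_one[of "t / c"] that c by (simp add: ln_div)
  have "ln a + (\<Sum>j\<in>A. ln (b j)) + (\<mu> - card A) * ln 1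
      \<le> (a / c - 1 + ln c) + (\<Sum>j\<in>A. b j / c - 1 + ln c) + (\<mu> - card A) * (1 / c - 1 + ln c)"
    using \<mu> a b by (intro add_mono sum_mono mult_left_mono tangent) auto
  also have "\<dots> = (a + sum b A - card A + \<mu>) / c - (\<mu> + 1) + (\<mu> + 1) * ln c"
    by (simp add: sum.distrib sum_subtractf sum_divide_distrib[symmetric] algebra_simps
        add_divide_distrib diff_divide_distrib)
  also have "\<dots> \<le> \<mu> / c - (\<mu> + 1) + (\<mu> + 1) * ln c"
    using le c by (intro add_right_mono diff_right_mono divide_right_mono) auto
  also have "\<dots> = (\<mu> + 1) * ln c"
    using \<mu> by (simp add: c_def)
  finally have "ln (a * prod b A) \<le> (\<mu> + 1) * ln c"
    using a b by (simp add: ln_mult prod_pos ln_prod \<open>finite A\<close> less_imp_neq[symmetric])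
  moreover have "a * prod b A > 0" using a b by (simp add: prod_pos)
  ultimately show ?thesis
    using c by (simp add: powr_def c_def[symmetric] ln_ge_iff flip: ln_le_cancel_iff)
qed

lemma prod_telescope_ratio:
  fixes x :: "nat \<Rightarrow> real"
  assumes "n \<le> s" and "\<And>j. n \<le> j \<Longrightarrow> x j \<noteq> 0"
  shows "(\<Prod>j=n+1..s. x (j - 1) / x j) = x n / x s"
  using assms(1)
proof (induction s rule: dec_induct)
  case base
  then show ?case using assms(2) by simp
next
  case (step s)
  then show ?case using assms(2)[of s] by simp
qed

text \<open>One round of the iteration. The growth factor \<open>w\<close> already known enters
  through \<open>rate\<close>, which pushes each backward ratio below 1 by at least
  \<open>w * P j\<close>; a total deficit of at least \<open>w * q * C\<close> forces the telescoped
  product to be small.\<close>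

lemma advanced_ratio_improvement:
  fixes x P :: "nat \<Rightarrow> real" and \<mu> q w :: real
  assumes pos: "\<And>j. n \<le> j \<Longrightarrow> x j > 0"
    and rate: "\<And>j. n < j \<Longrightarrow> x j - x (j - 1) \<ge> w * P j * x j"
    and s: "n \<le> s" "real (s - n) \<le> \<mu>"
    and w: "w > 0" and q: "q > 0" and \<mu>: "\<mu> > 0"
    and S: "(\<Sum>j=n+1..s. P j) \<ge> q * (\<mu> / (\<mu> + 1)) powr (\<mu> + 1)"
  shows "x s \<ge> q * w * x n"
proof -
  define C where "C = (\<mu> / (\<mu> + 1)) powr (\<mu> + 1)"
  define b where "b j = x (j - 1) / x j" for j
  have C: "C > 0" using \<mu> by (simp add: C_def)
  have bpos: "b j > 0" if "j \<in> {n+1..s}" for j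
    using that pos[of j] pos[of "j - 1"] by (auto simp: b_def)
  have bP: "b j \<le> 1 - w * P j" if "j \<in> {n+1..s}" for j
    using that rate[of j] pos[of j] by (simp add: b_def field_simps)
  have "sum b {n+1..s} \<le> (\<Sum>j=n+1..s. 1 - w * P j)"
    by (intro sum_mono bP)
  also have "\<dots> = card {n+1..s} - w * (\<Sum>j=n+1..s. P j)"
    by (simp add: sum_subtractf sum_distrib_left)
  also have "\<dots> \<le> card {n+1..s} - w * (q * C)"
    using S w by (simp add: C_def)
  finally have "w * (q * C) + sum b {n+1..s} \<le> card {n+1..s}" by simp
  \<comment> \<open>The deficit \<open>w * (q * C)\<close> serves as the extra positive number
    \<open>a\<close> in the AM-GM bound. Its factor \<open>C\<close> equals the bound itself and
    cancels below, leaving the gain \<open>q\<close>.\<close>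
  then have "w * (q * C) * prod b {n+1..s} \<le> C"
    unfolding C_def
    using w q C \<mu> s bpos by (intro mult_prod_le_powr) (auto simp: C_def)
  moreover have "prod b {n+1..s} = x n / x s"
    unfolding b_def using s pos by (intro prod_telescope_ratio) (auto simp: less_imp_neq[symmetric])
  ultimately have "C * (q * w * (x n / x s)) \<le> C * 1"
    by (simp add: mult_ac)
  then have "q * w * (x n / x s) \<le> 1" using C by (subst (asm) mult_le_cancel_left_pos)
  then show ?thesis using pos[of s] s by (simp add: field_simps)
qed

lemma less_liminf_imp_eventually_factor:
  fixes f :: "nat \<Rightarrow> real"
  assumes "c > 0" and "ereal c < liminf (\<lambda>n. ereal (f n))"
  shows "\<exists>q>1. \<forall>\<^sub>F n in sequentially. q * c \<le> f n"
proof -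
  \<comment> \<open>The lower limit may be infinite, so the slack is measured by a real
    \<open>y\<close> strictly in between; then \<open>q = y / c\<close>.\<close>
  obtain y where y: "ereal c < ereal y" "ereal y < liminf (\<lambda>n. ereal (f n))"
    using ereal_dense2[OF assms(2)] by blast
  have "\<forall>\<^sub>F n in sequentially. y < f n"
    using less_LiminfD[OF y(2)] by simp
  then have "\<forall>\<^sub>F n in sequentially. y / c * c \<le> f n"
    using assms(1) by (auto elim: eventually_mono)
  moreover have "y / c > 1" using y assms(1) by simp
  ultimately show ?thesis by blast
qed

text \<open>All advanced arguments must improve by the same factor in each round. Finiteness of
  \<open>K\<close> lets the least of the individual factors serve, with a common threshold.\<close>

lemma eventually_common_factor:
  fixes f :: "'k \<Rightarrow> nat \<Rightarrow> real" and c :: "'k \<Rightarrow> real"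
  assumes "finite K" and c: "\<And>k. k \<in> K \<Longrightarrow> c k > 0"
    and lim: "\<And>k. k \<in> K \<Longrightarrow> ereal (c k) < liminf (\<lambda>n. ereal (f k n))"
  shows "\<exists>q>1. \<forall>\<^sub>F n in sequentially. \<forall>k\<in>K. q * c k \<le> f k n"
proof -
  have "\<forall>k\<in>K. \<exists>q>1. \<forall>\<^sub>F n in sequentially. q * c k \<le> f k n"
    using less_liminf_imp_eventually_factor c lim by blast
  then obtain r where r: "\<And>k. k \<in> K \<Longrightarrow> r k > 1"
    "\<And>k. k \<in> K \<Longrightarrow> \<forall>\<^sub>F n in sequentially. r k * c k \<le> f k n"
    by metis
  \<comment> \<open>Inserting 2 keeps \<open>Min\<close> meaningful for empty
    \<open>K\<close>.\<close>
  define q where "q = Min (insert 2 (r ` K))"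
  have q: "q > 1" using r(1) \<open>finite K\<close> by (auto simp: q_def)
  have "\<forall>\<^sub>F n in sequentially. q * c k \<le> f k n" if k: "k \<in> K" for k
  proof -
    have "q * c k \<le> r k * c k"
      using k c[OF k] \<open>finite K\<close> by (intro mult_right_mono) (auto simp: q_def)
    then show ?thesis using r(2)[OF k] by (auto elim: eventually_mono)
  qed
  then show ?thesis using q \<open>finite K\<close> by (auto simp: eventually_ball_finite_distrib)
qed

lemma no_eventually_positive_solution:
  fixes p :: "nat \<Rightarrow> nat \<Rightarrow> real" and \<sigma> :: "nat \<Rightarrow> nat \<Rightarrow> int" and \<mu> :: "nat \<Rightarrow> real"
  assumes m: "m \<ge> 1"
    and p: "\<And>i n. i \<in> {1..m} \<Longrightarrow> n \<ge> 1 \<Longrightarrow> p i n \<ge> 0"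
    and \<sigma>: "\<And>i n. i \<in> {1..m} \<Longrightarrow> n \<ge> 1 \<Longrightarrow> \<sigma> i n \<ge> int n + 1"
    and \<mu>: "\<And>i. i \<in> {1..m} \<Longrightarrow> \<mu> i > 0"
    and \<sigma>\<mu>: "\<And>i n. i \<in> {1..m} \<Longrightarrow> n \<ge> 1 \<Longrightarrow> real_of_int (\<sigma> i n - int n) \<le> \<mu> i"
    and lim: "\<And>k. k \<in> {1..m} \<Longrightarrow>
      liminf (\<lambda>n. ereal (\<Sum>i=1..m. \<Sum>j=n+1..nat (\<sigma> k n). p i j))
        > ereal ((\<mu> k / (\<mu> k + 1)) powr (\<mu> k + 1))"
    and sol: "is_solution m p \<sigma> x"
  shows "\<not> (\<forall>\<^sub>F n in sequentially. x n > 0)"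
proof
  assume ev: "\<forall>\<^sub>F n in sequentially. x n > 0"
  define P where "P j = (\<Sum>i=1..m. p i j)" for j
  define C where "C k = (\<mu> k / (\<mu> k + 1)) powr (\<mu> k + 1)" for k
  have "\<exists>q>1. \<forall>\<^sub>F n in sequentially.
      \<forall>k\<in>{1..m}. q * C k \<le> (\<Sum>i=1..m. \<Sum>j=n+1..nat (\<sigma> k n). p i j)"
    using \<mu> lim by (intro eventually_common_factor) (force simp: C_def)+
  then obtain q where q: "q > 1" and evq: "\<forall>\<^sub>F n in sequentially.
      \<forall>k\<in>{1..m}. q * C k \<le> (\<Sum>i=1..m. \<Sum>j=n+1..nat (\<sigma> k n). p i j)"
    by blast
  from ev evq eventually_ge_at_top[of 1] have "\<forall>\<^sub>F n in sequentially. x n > 0 \<and>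
      (\<forall>k\<in>{1..m}. q * C k \<le> (\<Sum>i=1..m. \<Sum>j=n+1..nat (\<sigma> k n). p i j)) \<and> n \<ge> 1"
    by eventually_elim simp
  then obtain N where N: "\<And>n. n \<ge> N \<Longrightarrow> x n > 0 \<and>
      (\<forall>k\<in>{1..m}. q * C k \<le> (\<Sum>i=1..m. \<Sum>j=n+1..nat (\<sigma> k n). p i j)) \<and> n \<ge> 1"
    unfolding eventually_sequentially by blast
  have xpos: "x n > 0" and n1: "n \<ge> 1" if "n \<ge> N" for n
    using N[OF that] by auto
  have sumP: "(\<Sum>j=n+1..nat (\<sigma> k n). P j) \<ge> q * C k" if "n \<ge> N" "k \<in> {1..m}" for n k
    using N[OF that(1)] that(2) sum.swap[of p] unfolding P_def by (metis sum.swap)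
  have \<sigma>gt: "nat (\<sigma> k n) > n" if "n \<ge> N" "k \<in> {1..m}" for n k
    using \<sigma>[OF that(2) n1[OF that(1)]] by linarith
  have eq: "x n - x (n - 1) = (\<Sum>i=1..m. p i n * x (nat (\<sigma> i n)))" if "n \<ge> N" for n
    using sol n1[OF that] by (simp add: is_solution_def backward_diff_def)
  \<comment> \<open>Every advanced index lies beyond \<open>N\<close>, so the right-hand side of the
    equation is nonnegative. This supplies the starting factor 1 of the iteration.\<close>
  have mono: "x n \<le> x s" if "n \<ge> N" "n \<le> s" for n s
    using that(2)
  proof (induction s rule: dec_induct)
    case (step s)
    have "(\<Sum>i=1..m. p i (Suc s) * x (nat (\<sigma> i (Suc s)))) \<ge> 0"
    proof (intro sum_nonneg mult_nonneg_nonneg)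
      fix i assume i: "i \<in> {1..m}"
      show "p i (Suc s) \<ge> 0" using p[OF i] by simp
      have "nat (\<sigma> i (Suc s)) \<ge> N" using \<sigma>gt[of "Suc s" i] i step that by linarith
      then show "x (nat (\<sigma> i (Suc s))) \<ge> 0" using xpos less_imp_le by blast
    qed
    then show ?case using eq[of "Suc s"] step that by simp
  qed simp
  \<comment> \<open>\<open>N\<close> is fixed before \<open>r\<close>, and the claim covers all
    \<open>n\<close> and \<open>k\<close> at once: a round at \<open>n\<close> uses the previous
    bound at every \<open>j > n\<close> and for every index \<open>i\<close> in the
    equation.\<close>
  have growth: "\<forall>n\<ge>N. \<forall>k\<in>{1..m}. x (nat (\<sigma> k n)) \<ge> q ^ r * x n" for r
  proof (induction r)
    case 0
    then show ?case using mono \<sigma>gt by (simp add: less_imp_le)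
  next
    case (Suc r)
    show ?case
    proof (intro allI ballI impI)
      fix n k assume n: "n \<ge> N" and k: "k \<in> {1..m}"
      have "x (nat (\<sigma> k n)) \<ge> q * q ^ r * x n"
      proof (rule advanced_ratio_improvement[where P = P and \<mu> = "\<mu> k"])
        show "x j > 0" if "n \<le> j" for j using that n xpos by simp
        show "x j - x (j - 1) \<ge> q ^ r * P j * x j" if "n < j" for j
        proof -
          have j: "j \<ge> N" using that n by simp
          have "q ^ r * P j * x j = (\<Sum>i=1..m. p i j * (q ^ r * x j))"
            by (simp add: P_def sum_distrib_left sum_distrib_right mult_ac)
          also have "\<dots> \<le> (\<Sum>i=1..m. p i j * x (nat (\<sigma> i j)))"
            using Suc.IH j p n1 by (intro sum_mono mult_left_mono) auto
          finally show ?thesis using eq[OF j] by simp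
        qed
        show "n \<le> nat (\<sigma> k n)" using \<sigma>gt[OF n k] by simp
        show "real (nat (\<sigma> k n) - n) \<le> \<mu> k"
          using \<sigma>\<mu>[OF k n1[OF n]] \<sigma>gt[OF n k] by (simp add: of_nat_diff)
        show "q ^ r > 0" "q > 0" "\<mu> k > 0" using q \<mu>[OF k] by auto
        show "(\<Sum>j=n+1..nat (\<sigma> k n). P j) \<ge> q * (\<mu> k / (\<mu> k + 1)) powr (\<mu> k + 1)"
          using sumP[OF n k] by (simp add: C_def)
      qed
      then show "x (nat (\<sigma> k n)) \<ge> q ^ Suc r * x n" by simp
    qed
  qed
  \<comment> \<open>At the single point \<open>N\<close> the ratio is a fixed number, which the
    powers of \<open>q > 1\<close> exceed; index 1 is available since
    \<open>m \<ge> 1\<close>.\<close>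
  obtain r where "x (nat (\<sigma> 1 N)) / x N < q ^ r"
    using real_arch_pow[OF q] by blast
  then have "x (nat (\<sigma> 1 N)) < q ^ r * x N"
    using xpos[of N] by (simp add: field_simps)
  moreover have "x (nat (\<sigma> 1 N)) \<ge> q ^ r * x N"
    using growth[of r] m by simp
  ultimately show False by simp
qed

text \<open>Linearity reduces eventually negative solutions to eventually positive ones.\<close>

lemma is_solution_uminus:
  "is_solution m p \<sigma> x \<Longrightarrow> is_solution m p \<sigma> (\<lambda>n. - x n)"
  by (auto simp: is_solution_def backward_diff_def sum_negf)

theorem theorem3:
  fixes m :: nat
    and p :: "nat \<Rightarrow> nat \<Rightarrow> real"
    and \<sigma> :: "nat \<Rightarrow> nat \<Rightarrow> int"
    and \<mu> :: "nat \<Rightarrow> real"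
  assumes "m \<ge> 1"
    and "\<And>i n. i \<in> {1..m} \<Longrightarrow> n \<ge> 1 \<Longrightarrow> p i n \<ge> 0"
    and "\<And>i n. i \<in> {1..m} \<Longrightarrow> n \<ge> 1 \<Longrightarrow> \<sigma> i n \<ge> int n + 1"
    and "\<And>i. i \<in> {1..m} \<Longrightarrow> \<mu> i > 0"
    and "\<And>i n. i \<in> {1..m} \<Longrightarrow> n \<ge> 1 \<Longrightarrow> real_of_int (\<sigma> i n - int n) \<le> \<mu> i"
    and "\<And>k. k \<in> {1..m} \<Longrightarrow>
      liminf (\<lambda>n. ereal (\<Sum>i=1..m. \<Sum>j=n+1..nat (\<sigma> k n). p i j))
        > ereal ((\<mu> k / (\<mu> k + 1)) powr (\<mu> k + 1))"
  shows "\<forall>x. is_solution m p \<sigma> x \<longrightarrow> oscillatory x"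
proof (intro allI impI)
  fix x assume sol: "is_solution m p \<sigma> x"
  have no_pos: "\<not> (\<forall>\<^sub>F n in sequentially. y n > 0)" if "is_solution m p \<sigma> y" for y
    using assms that by (rule no_eventually_positive_solution)
  show "oscillatory x"
    using no_pos[OF sol] no_pos[OF is_solution_uminus[OF sol]] by (simp add: oscillatory_def)
qed

end
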